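(* Let $n$ be a positive integer. Suppose that $(\mathcal{A},\mathcal{B})$ is an $(n,n)$-bounded cross intersecting set pair system of size $m$ such that $\mathcal{A}$ is a linear hypergraph. Then $m\le n^2+n+1$.
   Context: A cross intersecting set pair system (SPS) of size $m\ge 2$ consists of finite sets $A_1,\dots,A_m$ and $B_1,\dots,B_m$ such that $A_i\cap B_i=\emptyset$ for every $1\le i\le m$ and $A_i\cap B_j\neq\emptyset$ for all $1\le i\neq j\le m$; one writes $\mathcal{A}=\{A_i\}_{i=1}^m$, $\mathcal{B}=\{B_i\}_{i=1}^m$. It is $(a,b)$-bounded if $|A_i|\le a$ and $|B_i|\le b$ for each $i$. A hypergraph is linear if any two different edges have at most one vertex in common; thus $\mathcal{A}$ is linear when $|A_i\cap A_j|\le 1$ for all $i\ne j$. *)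

theory Defs
  imports Main
begin

(* A pair of families is given by functions on nat of which only the values on {1..m} matter.
   Families are indexed, so repeated members are not excluded by the encoding. *)

definition cross_intersecting_SPS ::
    "nat \<Rightarrow> (nat \<Rightarrow> 'a set) \<Rightarrow> (nat \<Rightarrow> 'a set) \<Rightarrow> bool" where
  "cross_intersecting_SPS m A B \<longleftrightarrow>
     2 \<le> m \<and>
     (\<forall>i\<in>{1..m}. finite (A i) \<and> finite (B i)) \<and>
     (\<forall>i\<in>{1..m}. A i \<inter> B i = {}) \<and>
     (\<forall>i\<in>{1..m}. \<forall>j\<in>{1..m}. i \<noteq> j \<longrightarrow> A i \<inter> B j \<noteq> {})"

definition bounded_SPS ::
    "nat \<Rightarrow> nat \<Rightarrow> nat \<Rightarrow> (nat \<Rightarrow> 'a set) \<Rightarrow> (nat \<Rightarrow> 'a set) \<Rightarrow> bool" where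
  "bounded_SPS a b m A B \<longleftrightarrow> (\<forall>i\<in>{1..m}. card (A i) \<le> a \<and> card (B i) \<le> b)"

(* A hypergraph is its set of edges, all assumed finite (card of an infinite set is 0). *)

definition linear_hypergraph :: "'a set set \<Rightarrow> bool" where
  "linear_hypergraph H \<longleftrightarrow> (\<forall>E\<in>H. \<forall>F\<in>H. E \<noteq> F \<longrightarrow> card (E \<inter> F) \<le> 1)"

(* In a cross intersecting SPS the A i are pairwise distinct, so linearity of the edge set
   is the same as the condition on pairs of distinct indices. *)

lemma cross_intersecting_SPS_inj_on:
  assumes "cross_intersecting_SPS m A B"
  shows "inj_on A {1..m}"
proof (rule inj_onI)
  fix i j assume ij: "i \<in> {1..m}" "j \<in> {1..m}" "A i = A j"
  show "i = j"
  proof (rule ccontr)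
    assume "i \<noteq> j"
    then have "A i \<inter> B j \<noteq> {}" "A j \<inter> B j = {}"
      using assms ij unfolding cross_intersecting_SPS_def by blast+
    then show False using ij by simp
  qed
qed

lemma linear_hypergraph_SPS_iff:
  assumes "cross_intersecting_SPS m A B"
  shows "linear_hypergraph (A ` {1..m}) \<longleftrightarrow>
    (\<forall>i\<in>{1..m}. \<forall>j\<in>{1..m}. i \<noteq> j \<longrightarrow> card (A i \<inter> A j) \<le> 1)"
proof -
  have "A i = A j \<longleftrightarrow> i = j" if "i \<in> {1..m}" "j \<in> {1..m}" for i j
    using cross_intersecting_SPS_inj_on[OF assms] that by (rule inj_on_eq_iff)
  then show ?thesis
    unfolding linear_hypergraph_def ball_simps by (intro ball_cong refl) simp
qed

end

theory Submission
  imports Defs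
begin

text \<open>
  Each \<open>B i\<close> is a transversal, with at most \<open>n\<close> points, of the \<open>m - 1\<close> edges \<open>A j\<close> with
  \<open>j \<noteq> i\<close>, so a bound \<open>d\<close> on the vertex degrees of \<open>A\<close> gives \<open>m - 1 \<le> d * n\<close>
  (\<open>card_le_transversal\<close>). The degrees are at most \<open>n + 1\<close> (\<open>SPS_degree_le\<close>): by linearity the
  edges through a point \<open>x\<close> are pairwise disjoint outside \<open>x\<close>. If \<open>A i\<close> is one of them, then
  \<open>B i\<close> avoids \<open>x\<close>, so it meets the other edges through \<open>x\<close> in distinct points, and there are at
  most \<open>n\<close> of them. Hence \<open>m - 1 \<le> (n + 1) * n\<close>.
\<close>

text \<open>Choosing a point of \<open>S\<close> on each edge assigns at most \<open>d\<close> edges to every point of \<open>S\<close>.\<close>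

lemma card_le_transversal:
  fixes A :: "'i \<Rightarrow> 'a set"
  assumes "finite I" and "finite S"
    and meets: "\<And>j. j \<in> I \<Longrightarrow> A j \<inter> S \<noteq> {}"
    and degree: "\<And>y. y \<in> S \<Longrightarrow> card {j \<in> I. y \<in> A j} \<le> d"
  shows "card I \<le> d * card S"
proof -
  have "I \<subseteq> (\<Union>y\<in>S. {j \<in> I. y \<in> A j})"
    using meets by blast
  then have "card I \<le> card (\<Union>y\<in>S. {j \<in> I. y \<in> A j})"
    using assms(1,2) by (intro card_mono) auto
  also have "\<dots> \<le> (\<Sum>y\<in>S. card {j \<in> I. y \<in> A j})"
    using assms(2) by (rule card_UN_le)
  also have "\<dots> \<le> d * card S"
    using sum_bounded_above[of S "\<lambda>y. card {j \<in> I. y \<in> A j}" d] degree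
    by (simp add: mult.commute)
  finally show ?thesis .
qed

text \<open>
  The edges through \<open>x\<close> other than \<open>A i\<close> have degree at most one at every point of \<open>B i\<close>, since two
  of them already share \<open>x\<close>.
\<close>

lemma SPS_degree_le:
  assumes sps: "cross_intersecting_SPS m A B"
    and linear: "linear_hypergraph (A ` {1..m})"
    and small: "\<And>i. i \<in> {1..m} \<Longrightarrow> card (B i) \<le> b"
  shows "card {j \<in> {1..m}. x \<in> A j} \<le> b + 1"
proof (cases "{j \<in> {1..m}. x \<in> A j} = {}")
  case True
  then show ?thesis by (simp only: card.empty)
next
  case False
  then obtain i where i: "i \<in> {1..m}" "x \<in> A i" by blast
  define star where "star = {j \<in> {1..m}. x \<in> A j}"
  have fin: "finite (star - {i})" "finite (B i)"
    using sps i(1) unfolding star_def cross_intersecting_SPS_def by auto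
  have "x \<notin> B i"
    using sps i unfolding cross_intersecting_SPS_def by blast
  have "card (star - {i}) \<le> 1 * card (B i)"
  proof (rule card_le_transversal[OF fin])
    show "A j \<inter> B i \<noteq> {}" if "j \<in> star - {i}" for j
      using sps i(1) that unfolding star_def cross_intersecting_SPS_def by blast
    show "card {j \<in> star - {i}. y \<in> A j} \<le> 1" if "y \<in> B i" for y
    proof -
      have "j = k" if jk: "j \<in> star" "k \<in> star" "y \<in> A j" "y \<in> A k" for j k
      proof (rule ccontr)
        assume "j \<noteq> k"
        then have "card (A j \<inter> A k) \<le> 1"
          using linear jk unfolding linear_hypergraph_SPS_iff[OF sps] star_def by blast
        moreover have "finite (A j \<inter> A k)"
          using sps jk unfolding cross_intersecting_SPS_def star_def by blast
        then have "card {x, y} \<le> card (A j \<inter> A k)"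
          using jk by (intro card_mono) (auto simp: star_def)
        moreover have "x \<noteq> y" using \<open>x \<notin> B i\<close> \<open>y \<in> B i\<close> by blast
        ultimately show False by simp
      qed
      then show ?thesis using fin(1) by (auto simp: card_le_Suc0_iff_eq)
    qed
  qed
  also have "\<dots> \<le> b" using small[OF i(1)] by simp
  finally have "card (star - {i}) \<le> b" .
  moreover have "i \<in> star" using i by (simp add: star_def)
  ultimately show ?thesis unfolding star_def[symmetric] by simp
qed

theorem proposition1p5:
  fixes n m :: nat and A B :: "nat \<Rightarrow> 'a set"
  assumes "0 < n"
    and "cross_intersecting_SPS m A B"
    and "bounded_SPS n n m A B"
    and "linear_hypergraph (A ` {1..m})"
  shows "m \<le> n^2 + n + 1"
proof -
  have small: "card (B i) \<le> n" if "i \<in> {1..m}" for i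
    using assms(3) that unfolding bounded_SPS_def by blast
  have one: "1 \<in> {1..m}" and fin: "finite (B 1)"
    using assms(2) unfolding cross_intersecting_SPS_def by auto
  have "card ({1..m} - {1}) \<le> (n + 1) * card (B 1)"
  proof (rule card_le_transversal[OF _ fin])
    show "A j \<inter> B 1 \<noteq> {}" if "j \<in> {1..m} - {1}" for j
      using assms(2) one that unfolding cross_intersecting_SPS_def by blast
    show "card {j \<in> {1..m} - {1}. y \<in> A j} \<le> n + 1" for y
    proof -
      have "card {j \<in> {1..m} - {1}. y \<in> A j} \<le> card {j \<in> {1..m}. y \<in> A j}"
        by (rule card_mono) auto
      also have "\<dots> \<le> n + 1"
        using assms(2,4) small by (rule SPS_degree_le)
      finally show ?thesis .
    qed
  qed simp
  also have "\<dots> \<le> (n + 1) * n"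
    using small[OF one] by (rule mult_le_mono2)
  finally have "m - 1 \<le> (n + 1) * n"
    using one by simp
  then show ?thesis by (simp add: power2_eq_square algebra_simps)
qed

end
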